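(* Consider the equation $$\dot{x}(t)+f(t,x(t))+\sum_{k=1}^m g_k(t,x(h_k(t)))=0,\quad t\geq 0,$$ with the initial condition $x(t)=\varphi(t)$, $t\leq 0$, where: (i) $h_1,\dots,h_m:[0,\infty)\to\mathbb{R}$ are Lebesgue measurable, $h_k(t)\leq t$ and $\lim_{t\to\infty}h_k(t)=\infty$; $\varphi:(-\infty,0]\to\mathbb{R}$ is Borel measurable and bounded; (ii) $f(t,u)$ and $g_k(t,u)$ are continuous, $f(t,0)=g_k(t,0)=0$, and $f(t,u)u>0$, $g_k(t,u)u>0$ for any $u\neq 0$ and $k=1,\dots,m$; (iii) there are $x_1^0,x_2^0,x_1,x_2$ with $-\infty\leq x_1^0\leq 0\leq x_2^0\leq\infty$ and $-\infty<x_1\leq 0\leq x_2<\infty$ such that for any $\varphi$ with $x_1^0\leq\varphi\leq x_2^0$ there exists a unique global solution $x$ of the initial value problem, and it satisfies $x_1\leq x(t)\leq x_2$. Suppose that there exist positive numbers $a_0,A,b_k$, $k=1,\dots,m$, such that for any $u$ with $x_1\leq u\leq x_2$, $u\neq 0$ (and all $t\ge 0$), $$a_0\leq\frac{f(t,u)}{u}\leq A,\qquad 0\leq\frac{g_k(t,u)}{u}\leq b_k,\quad k=1,\dots,m.$$ Assume also that $t-h_k(t)\leq h_0$ for some constant $h_0$ and all $k$, that $b_0=\sum_{k=1}^m b_k$, and that $$\frac{a_0}{b_0}e^{-Ah_0}>\ln\frac{b_0^2+a_0b_0}{b_0^2+a_0^2}.$$ Then every solution $x$ of the initial value problem with $x_1^0\leq\varphi\leq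 x_2^0$ converges to zero, i.e. $\lim_{t\to\infty}x(t)=0$.
   Context: A solution of the initial value problem is a function $x$ that is absolutely continuous on $[0,\infty)$ (i.e. on its bounded subintervals), satisfies the differential equation for almost every $t\geq 0$, and satisfies $x(t)=\varphi(t)$ for $t\leq 0$. Inequalities $x_1^0\leq\varphi\leq x_2^0$ are understood pointwise on $(-\infty,0]$. *)

theory Defs
  imports "HOL-Analysis.Analysis"
begin

text \<open>
  Absolute continuity of a function on a compact interval, in the usual epsilon-delta form
  over finite families of non-overlapping subintervals. (The library constant
  \<open>absolutely_continuous\<close> is a relation between measures.)
\<close>
definition abs_continuous_on_interval :: "real \<Rightarrow> real \<Rightarrow> (real \<Rightarrow> real) \<Rightarrow> bool" where
  "abs_continuous_on_interval a b F \<longleftrightarrow>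
     (\<forall>\<epsilon>>0. \<exists>\<delta>>0. \<forall>(n::nat) (u::nat \<Rightarrow> real) (v::nat \<Rightarrow> real).
        (\<forall>i<n. a \<le> u i \<and> u i \<le> v i \<and> v i \<le> b) \<longrightarrow>
        disjoint_family_on (\<lambda>i. {u i<..<v i}) {..<n} \<longrightarrow>
        (\<Sum>i<n. v i - u i) < \<delta> \<longrightarrow>
        (\<Sum>i<n. \<bar>F (v i) - F (u i)\<bar>) < \<epsilon>)"

text \<open>
  Functions on half-lines are total functions on the reals of which only the values on the
  relevant half-line are constrained or used.
\<close>
definition initial_function :: "(real \<Rightarrow> real) \<Rightarrow> bool" where
  "initial_function \<phi> \<longleftrightarrow>
     \<phi> \<in> borel_measurable (restrict_space borel {..0}) \<and> bounded (\<phi> ` {..0})"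

text \<open>
  The bounds are extended reals, since they may be infinite.
\<close>
definition initial_function_between :: "ereal \<Rightarrow> ereal \<Rightarrow> (real \<Rightarrow> real) \<Rightarrow> bool" where
  "initial_function_between l r \<phi> \<longleftrightarrow>
     initial_function \<phi> \<and> (\<forall>t\<le>0. l \<le> ereal (\<phi> t) \<and> ereal (\<phi> t) \<le> r)"

text \<open>
  Global solutions. The condition on \<open>{..0}\<close> together with the equation on \<open>{0..}\<close> constrains
  every value of \<open>x\<close>, so uniqueness of a solution is plain equality of functions.
\<close>
definition is_solution ::
  "nat \<Rightarrow> (real \<Rightarrow> real \<Rightarrow> real) \<Rightarrow> (nat \<Rightarrow> real \<Rightarrow> real \<Rightarrow> real) \<Rightarrow> (nat \<Rightarrow> real \<Rightarrow> real)
     \<Rightarrow> (real \<Rightarrow> real) \<Rightarrow> (real \<Rightarrow> real) \<Rightarrow> bool" where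
  "is_solution m f g h \<phi> x \<longleftrightarrow>
     (\<forall>a b. 0 \<le> a \<and> a \<le> b \<longrightarrow> abs_continuous_on_interval a b x) \<and>
     (AE t in lebesgue_on {0..}. \<exists>D. (x has_real_derivative D) (at t) \<and>
        D + f t (x t) + (\<Sum>k=1..m. g k t (x (h k t))) = 0) \<and>
     (\<forall>t\<le>0. x t = \<phi> t)"

end

theory Submission
  imports Defs
begin

text \<open>
  Write \<open>q = b0 / a0\<close> and enlarge the delay bound to \<open>H\<close> with \<open>exp (A * H) \<ge> 1 + 1 / q\<close>, which does not
  destroy the hypothesis. If \<open>x\<close> eventually has no zeros it decays exponentially. Otherwise suppose
  \<open>\<bar>x\<bar> \<le> \<mu>\<close> eventually and look at a late zero \<open>\<xi>\<close> after which \<open>x > 0\<close>. Going backward from \<open>\<xi>\<close> gives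
  \<open>- x u \<le> \<mu> * min 1 (q * (exp (A * (\<xi> - u)) - 1))\<close>; feeding this into the delayed terms and going
  forward from \<open>\<xi>\<close> bounds \<open>x\<close> on \<open>[\<xi>, \<xi> + H]\<close> by an explicit profile whose maximum is at most
  \<open>\<kappa> * \<mu>\<close>, where \<open>\<kappa> < 1\<close> is exactly the logarithmic hypothesis. After \<open>\<xi> + H\<close> the solution decreases
  until its next zero. The same applies to \<open>- x\<close>, so the bound \<open>\<mu>\<close> contracts to \<open>\<kappa> * \<mu>\<close>, and iteration
  gives convergence to zero. The rates \<open>A\<close> (backward, where \<open>x < 0\<close>) and \<open>a0\<close> (forward, where \<open>x > 0\<close>)
  come from the two-sided bound on \<open>f t u / u\<close>.
\<close>

subsection \<open>Absolutely continuous functions\<close>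

lemma abs_continuous_on_intervalD:
  assumes "abs_continuous_on_interval a b F" "0 < \<epsilon>"
  obtains \<delta> where "0 < \<delta>"
    "\<And>(n::nat) u v. \<lbrakk>\<And>i. i < n \<Longrightarrow> a \<le> u i \<and> u i \<le> v i \<and> v i \<le> b;
       disjoint_family_on (\<lambda>i. {u i<..<v i}) {..<n}; (\<Sum>i<n. v i - u i) < \<delta>\<rbrakk>
       \<Longrightarrow> (\<Sum>i<n. \<bar>F (v i) - F (u i)\<bar>) < \<epsilon>"
  using assms unfolding abs_continuous_on_interval_def by meson

lemma abs_continuous_on_interval_subset:
  assumes "abs_continuous_on_interval a b F" "a \<le> c" "d \<le> b"
  shows "abs_continuous_on_interval c d F"
  unfolding abs_continuous_on_interval_def
proof (intro allI impI)
  fix \<epsilon> :: real assume "0 < \<epsilon>"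
  from abs_continuous_on_intervalD[OF assms(1) this] obtain \<delta> where \<delta>: "0 < \<delta>"
    "\<And>(n::nat) u v. \<lbrakk>\<And>i. i < n \<Longrightarrow> a \<le> u i \<and> u i \<le> v i \<and> v i \<le> b;
       disjoint_family_on (\<lambda>i. {u i<..<v i}) {..<n}; (\<Sum>i<n. v i - u i) < \<delta>\<rbrakk>
       \<Longrightarrow> (\<Sum>i<n. \<bar>F (v i) - F (u i)\<bar>) < \<epsilon>" by blast
  have "(\<Sum>i<n. \<bar>F (v i) - F (u i)\<bar>) < \<epsilon>"
    if uv: "\<forall>i<n. c \<le> u i \<and> u i \<le> v i \<and> v i \<le> d"
      and "disjoint_family_on (\<lambda>i. {u i<..<v i}) {..<n}" "(\<Sum>i<n. v i - u i) < \<delta>"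
    for n :: nat and u v :: "nat \<Rightarrow> real"
    by (rule \<delta>(2)) (use that assms(2,3) in force)+
  then show "\<exists>\<delta>>0. \<forall>(n::nat) u v. (\<forall>i<n. c \<le> u i \<and> u i \<le> v i \<and> v i \<le> d) \<longrightarrow>
        disjoint_family_on (\<lambda>i. {u i<..<v i}) {..<n} \<longrightarrow> (\<Sum>i<n. v i - u i) < \<delta> \<longrightarrow>
        (\<Sum>i<n. \<bar>F (v i) - F (u i)\<bar>) < \<epsilon>"
    using \<delta>(1) by blast
qed

text \<open>Common source for negation, difference, product and the smooth case: the increment bound
  is summed over a family of subintervals, each sum on the right being at most
  \<open>\<eta> = \<epsilon> / (B + C + 1)\<close>. The extra 1 makes the final estimate
  strict.\<close>

lemma abs_continuous_on_interval_lipschitz_combination: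
  assumes "abs_continuous_on_interval a b F" "abs_continuous_on_interval a b G" "0 \<le> B" "0 \<le> C"
    and bound: "\<And>u v. \<lbrakk>a \<le> u; u \<le> v; v \<le> b\<rbrakk> \<Longrightarrow> \<bar>K v - K u\<bar> \<le> B * \<bar>F v - F u\<bar> + C * \<bar>G v - G u\<bar>"
  shows "abs_continuous_on_interval a b K"
  unfolding abs_continuous_on_interval_def
proof (intro allI impI)
  fix \<epsilon> :: real assume \<epsilon>: "0 < \<epsilon>"
  define \<eta> where "\<eta> = \<epsilon> / (B + C + 1)"
  have \<eta>: "0 < \<eta>" using \<epsilon> assms by (simp add: \<eta>_def)
  obtain \<delta>1 where \<delta>1: "0 < \<delta>1"
    "\<And>(n::nat) u v. \<lbrakk>\<And>i. i < n \<Longrightarrow> a \<le> u i \<and> u i \<le> v i \<and> v i \<le> b;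
       disjoint_family_on (\<lambda>i. {u i<..<v i}) {..<n}; (\<Sum>i<n. v i - u i) < \<delta>1\<rbrakk>
       \<Longrightarrow> (\<Sum>i<n. \<bar>F (v i) - F (u i)\<bar>) < \<eta>"
    using abs_continuous_on_intervalD[OF assms(1) \<eta>] by blast
  obtain \<delta>2 where \<delta>2: "0 < \<delta>2"
    "\<And>(n::nat) u v. \<lbrakk>\<And>i. i < n \<Longrightarrow> a \<le> u i \<and> u i \<le> v i \<and> v i \<le> b;
       disjoint_family_on (\<lambda>i. {u i<..<v i}) {..<n}; (\<Sum>i<n. v i - u i) < \<delta>2\<rbrakk>
       \<Longrightarrow> (\<Sum>i<n. \<bar>G (v i) - G (u i)\<bar>) < \<eta>"
    using abs_continuous_on_intervalD[OF assms(2) \<eta>] by blast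
  have key: "(\<Sum>i<n. \<bar>K (v i) - K (u i)\<bar>) < \<epsilon>"
    if uv: "\<forall>i<n. a \<le> u i \<and> u i \<le> v i \<and> v i \<le> b"
      and dis: "disjoint_family_on (\<lambda>i. {u i<..<v i}) {..<n}"
      and small: "(\<Sum>i<n. v i - u i) < min \<delta>1 \<delta>2" for n :: nat and u v :: "nat \<Rightarrow> real"
  proof -
    have 1: "(\<Sum>i<n. \<bar>F (v i) - F (u i)\<bar>) \<le> \<eta>" using \<delta>1(2)[of n u v] uv dis small by auto
    have 2: "(\<Sum>i<n. \<bar>G (v i) - G (u i)\<bar>) \<le> \<eta>" using \<delta>2(2)[of n u v] uv dis small by auto
    have "(\<Sum>i<n. \<bar>K (v i) - K (u i)\<bar>)
        \<le> (\<Sum>i<n. B * \<bar>F (v i) - F (u i)\<bar> + C * \<bar>G (v i) - G (u i)\<bar>)"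
      by (intro sum_mono bound) (use uv in auto)
    also have "\<dots> = B * (\<Sum>i<n. \<bar>F (v i) - F (u i)\<bar>) + C * (\<Sum>i<n. \<bar>G (v i) - G (u i)\<bar>)"
      by (simp add: sum.distrib sum_distrib_left)
    also have "\<dots> \<le> B * \<eta> + C * \<eta>" using 1 2 assms by (intro add_mono mult_left_mono)
    also have "\<dots> < (B + C + 1) * \<eta>" using \<eta> by (simp add: algebra_simps)
    also have "\<dots> = \<epsilon>" using assms by (simp add: \<eta>_def)
    finally show ?thesis .
  qed
  show "\<exists>\<delta>>0. \<forall>(n::nat) u v. (\<forall>i<n. a \<le> u i \<and> u i \<le> v i \<and> v i \<le> b) \<longrightarrow>
        disjoint_family_on (\<lambda>i. {u i<..<v i}) {..<n} \<longrightarrow> (\<Sum>i<n. v i - u i) < \<delta> \<longrightarrow>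
        (\<Sum>i<n. \<bar>K (v i) - K (u i)\<bar>) < \<epsilon>"
  proof (intro exI[of _ "min \<delta>1 \<delta>2"] conjI allI impI)
    show "0 < min \<delta>1 \<delta>2" using \<delta>1(1) \<delta>2(1) by simp
  qed (rule key)
qed

lemma abs_continuous_on_interval_minus:
  "abs_continuous_on_interval a b F \<Longrightarrow> abs_continuous_on_interval a b (\<lambda>t. - F t)"
  by (rule abs_continuous_on_interval_lipschitz_combination[of _ _ F F 1 0]) auto

lemma abs_continuous_on_interval_diff:
  assumes "abs_continuous_on_interval a b F" "abs_continuous_on_interval a b G"
  shows "abs_continuous_on_interval a b (\<lambda>t. F t - G t)"
  by (rule abs_continuous_on_interval_lipschitz_combination[OF assms, of 1 1]) auto

lemma abs_continuous_on_interval_imp_continuous_on: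
  assumes "abs_continuous_on_interval a b F"
  shows "continuous_on {a..b} F"
  unfolding continuous_on_iff
proof (intro ballI allI impI)
  fix s e :: real assume s: "s \<in> {a..b}" and e: "0 < e"
  obtain \<delta> where \<delta>: "0 < \<delta>"
    "\<And>(n::nat) u v. \<lbrakk>\<And>i. i < n \<Longrightarrow> a \<le> u i \<and> u i \<le> v i \<and> v i \<le> b;
       disjoint_family_on (\<lambda>i. {u i<..<v i}) {..<n}; (\<Sum>i<n. v i - u i) < \<delta>\<rbrakk>
       \<Longrightarrow> (\<Sum>i<n. \<bar>F (v i) - F (u i)\<bar>) < e"
    using abs_continuous_on_intervalD[OF assms e] by blast
  have "dist (F t) (F s) < e" if "t \<in> {a..b}" "dist t s < \<delta>" for t
    using \<delta>(2)[of 1 "\<lambda>_. min s t" "\<lambda>_. max s t"] s that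
    by (cases "s \<le> t")
      (auto simp: disjoint_family_on_def dist_real_def max_def min_def abs_minus_commute)
  then show "\<exists>d>0. \<forall>t\<in>{a..b}. dist t s < d \<longrightarrow> dist (F t) (F s) < e"
    using \<delta>(1) by blast
qed

lemma abs_continuous_on_interval_mult:
  assumes "abs_continuous_on_interval a b F" "abs_continuous_on_interval a b G"
  shows "abs_continuous_on_interval a b (\<lambda>t. F t * G t)"
proof -
  have bdd: "\<exists>B\<ge>0. \<forall>t\<in>{a..b}. \<bar>H t\<bar> \<le> B" if "abs_continuous_on_interval a b H" for H
  proof -
    have "bounded (H ` {a..b})"
      by (intro compact_imp_bounded compact_continuous_image
          abs_continuous_on_interval_imp_continuous_on[OF that]) simp
    then show ?thesis unfolding bounded_pos by (auto intro: less_imp_le)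
  qed
  obtain B C where B: "0 \<le> B" "\<And>t. t \<in> {a..b} \<Longrightarrow> \<bar>F t\<bar> \<le> B"
    and C: "0 \<le> C" "\<And>t. t \<in> {a..b} \<Longrightarrow> \<bar>G t\<bar> \<le> C"
    using bdd[OF assms(1)] bdd[OF assms(2)] by metis
  show ?thesis
  proof (rule abs_continuous_on_interval_lipschitz_combination[OF assms C(1) B(1)])
    fix u v assume "a \<le> u" "u \<le> v" "v \<le> b"
    then have "\<bar>G v\<bar> \<le> C" "\<bar>F u\<bar> \<le> B" using B(2)[of u] C(2)[of v] by auto
    have "F v * G v - F u * G u = G v * (F v - F u) + F u * (G v - G u)"
      by (simp add: algebra_simps)
    also have "\<bar>\<dots>\<bar> \<le> \<bar>G v\<bar> * \<bar>F v - F u\<bar> + \<bar>F u\<bar> * \<bar>G v - G u\<bar>"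
      by (metis abs_mult abs_triangle_ineq)
    also have "\<dots> \<le> C * \<bar>F v - F u\<bar> + B * \<bar>G v - G u\<bar>"
      using \<open>\<bar>G v\<bar> \<le> C\<close> \<open>\<bar>F u\<bar> \<le> B\<close> by (intro add_mono mult_right_mono) auto
    finally show "\<bar>F v * G v - F u * G u\<bar> \<le> C * \<bar>F v - F u\<bar> + B * \<bar>G v - G u\<bar>" .
  qed
qed

text \<open>The mean value inequality makes \<open>F\<close> Lipschitz, and the identity is
  absolutely continuous with \<open>\<delta> = \<epsilon>\<close>. This admits explicit comparison
  functions to the arguments below.\<close>

lemma abs_continuous_on_interval_C1:
  assumes deriv: "\<And>t. t \<in> {a..b} \<Longrightarrow> (F has_real_derivative F' t) (at t)"
    and cont: "continuous_on {a..b} F'"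
  shows "abs_continuous_on_interval a b F"
proof -
  have "bounded (F' ` {a..b})"
    by (intro compact_imp_bounded compact_continuous_image cont) simp
  then have "\<exists>B>0. \<forall>t\<in>{a..b}. \<bar>F' t\<bar> \<le> B"
    unfolding bounded_pos by auto
  then obtain B where B: "0 < B" "\<forall>t\<in>{a..b}. \<bar>F' t\<bar> \<le> B" by blast
  have id: "abs_continuous_on_interval a b (\<lambda>t. t)"
    unfolding abs_continuous_on_interval_def
    by (intro allI impI) (rule_tac x = \<epsilon> in exI, auto)
  show ?thesis
  proof (rule abs_continuous_on_interval_lipschitz_combination[OF id id])
    show "0 \<le> B" "0 \<le> (0::real)" using B by auto
    fix u v :: real assume uv: "a \<le> u" "u \<le> v" "v \<le> b"
    show "\<bar>F v - F u\<bar> \<le> B * \<bar>v - u\<bar> + 0 * \<bar>v - u\<bar>"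
    proof -
      have "norm (F v - F u) \<le> B * norm (v - u)"
        by (rule field_differentiable_bound[of "{u..v}" F F'])
          (use uv B deriv in \<open>auto intro: has_field_derivative_at_within\<close>)
      then show ?thesis by simp
    qed
  qed
qed

text \<open>Cousin's lemma supplies a division whose cells are tagged either outside the exceptional set,
  where the derivative controls the increment, or inside it; the latter cells have small total length
  because they lie in an open set of small measure.\<close>
lemma abs_continuous_nonincreasing:
  assumes ac: "abs_continuous_on_interval a b F" and "a \<le> b" and N: "negligible N"
    and deriv: "\<And>t. t \<in> {a<..<b} - N \<Longrightarrow> \<exists>D\<le>0. (F has_real_derivative D) (at t)"
  shows "F b \<le> F a"
proof (rule field_le_epsilon)
  fix e :: real assume e: "0 < e"
  \<comment> \<open>The cells tagged outside the exceptional set will contribute at most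
    \<open>\<epsilon> * (b - a)\<close>, the others at most \<open>\<epsilon>\<close>.\<close>
  define \<epsilon> where "\<epsilon> = e / (b - a + 1)"
  have \<epsilon>: "0 < \<epsilon>" using e \<open>a \<le> b\<close> by (simp add: \<epsilon>_def)
  obtain \<delta> where \<delta>: "0 < \<delta>"
    "\<And>(n::nat) u v. \<lbrakk>\<And>i. i < n \<Longrightarrow> a \<le> u i \<and> u i \<le> v i \<and> v i \<le> b;
       disjoint_family_on (\<lambda>i. {u i<..<v i}) {..<n}; (\<Sum>i<n. v i - u i) < \<delta>\<rbrakk>
       \<Longrightarrow> (\<Sum>i<n. \<bar>F (v i) - F (u i)\<bar>) < \<epsilon>"
    using abs_continuous_on_intervalD[OF ac \<epsilon>] by blast
  \<comment> \<open>The endpoints join the exceptional set: they may be tags, but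
    \<open>deriv\<close> speaks only of the open interval.\<close>
  define N' where "N' = N \<union> {a, b}"
  have "negligible N'" unfolding N'_def using N by (simp add: negligible_Un)
  then have N': "N' \<in> lmeasurable" "measure lebesgue N' = 0"
    using negligible_imp_measurable negligible_imp_measure0 by auto
  obtain U where U: "open U" "N' \<subseteq> U" "U - N' \<in> lmeasurable" "emeasure lebesgue (U - N') < ennreal \<delta>"
    using sets_lebesgue_outer_open[of N' \<delta>] \<delta>(1) N'(1) by (auto simp: fmeasurable_def)
  have "U = (U - N') \<union> N'" using U(2) by auto
  then have "U \<in> lmeasurable" "measure lebesgue U \<le> measure lebesgue (U - N') + measure lebesgue N'"
    using U(3) N'(1) fmeasurable.Un measure_Un_le by (metis fmeasurableD)+
  moreover have "measure lebesgue (U - N') < \<delta>"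
    using U(3,4) by (simp add: emeasure_eq_measure2 ennreal_less_iff)
  ultimately have U: "open U" "N' \<subseteq> U" "U \<in> lmeasurable" "measure lebesgue U < \<delta>"
    using U N' by auto
  \<comment> \<open>Construction of the gauge. A tag in \<open>N'\<close> gets a neighbourhood
    inside \<open>U\<close>; any other tag in the interval gets a ball on which the nonpositive
    derivative gives the straddle estimate for \<open>u \<le> t \<le> v\<close>.\<close>
  have "\<exists>G. open G \<and> t \<in> G \<and> (t \<in> N' \<longrightarrow> G \<subseteq> U) \<and>
      (t \<notin> N' \<longrightarrow> t \<in> {a..b} \<longrightarrow> (\<forall>u\<in>G. \<forall>v\<in>G. u \<le> t \<longrightarrow> t \<le> v \<longrightarrow> F v - F u \<le> \<epsilon> * (v - u)))" for t
  proof (cases "t \<notin> N' \<and> t \<in> {a..b}")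
    case False
    then show ?thesis using U by (cases "t \<in> N'") (auto intro: exI[of _ U] exI[of _ UNIV])
  next
    case True
    then have "t \<in> {a<..<b} - N" by (auto simp: N'_def)
    from deriv[OF this] obtain D where D: "D \<le> 0" "(F has_derivative (\<lambda>h. D * h)) (at t)"
      unfolding has_field_derivative_def by auto
    obtain d where d: "0 < d" "\<And>y. \<bar>y - t\<bar> < d \<Longrightarrow> \<bar>F y - F t - D * (y - t)\<bar> \<le> \<epsilon> * \<bar>y - t\<bar>"
      using D(2) \<epsilon> unfolding has_derivative_at_alt by (auto simp: algebra_simps)
    have "F v - F u \<le> \<epsilon> * (v - u)" if "u \<in> ball t d" "v \<in> ball t d" "u \<le> t" "t \<le> v" for u v
    proof -
      have "\<bar>F v - F t - D * (v - t)\<bar> \<le> \<epsilon> * (v - t)" "\<bar>F u - F t - D * (u - t)\<bar> \<le> \<epsilon> * (t - u)"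
        using d(2)[of v] d(2)[of u] that by (auto simp: dist_real_def)
      then have "F v - F t - D * (v - t) \<le> \<epsilon> * (v - t)" "- (F u - F t - D * (u - t)) \<le> \<epsilon> * (t - u)"
        by linarith+
      moreover have "D * (v - t) + D * (t - u) \<le> 0"
        using D(1) that by (intro add_nonpos_nonpos mult_nonpos_nonneg) auto
      ultimately show ?thesis by (simp add: algebra_simps)
    qed
    then show ?thesis using d(1) True by (intro exI[of _ "ball t d"]) auto
  qed
  then obtain G where G: "\<And>t. open (G t)" "\<And>t. t \<in> G t" "\<And>t. t \<in> N' \<Longrightarrow> G t \<subseteq> U"
    "\<And>t u v. \<lbrakk>t \<notin> N'; t \<in> {a..b}; u \<in> G t; v \<in> G t; u \<le> t; t \<le> v\<rbrakk> \<Longrightarrow> F v - F u \<le> \<epsilon> * (v - u)"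
    by metis
  have "gauge G" using G(1,2) by (simp add: gauge_def)
  then obtain p where p: "p tagged_division_of {a..b}" "G fine p"
    using fine_division_exists_real by blast
  have fin: "finite p" using p(1) by blast
  have cell: "\<exists>u v. K = {u..v} \<and> a \<le> u \<and> u \<le> t \<and> t \<le> v \<and> v \<le> b \<and> {u..v} \<subseteq> G t" if tK: "(t, K) \<in> p" for t K
  proof -
    obtain u v where K: "K = cbox u v" using tagged_division_ofD(4)[OF p(1) tK] by blast
    moreover have "t \<in> K" "K \<subseteq> {a..b}" using tagged_division_ofD(2,3)[OF p(1) tK] .
    moreover have "K \<subseteq> G t" using p(2) tK by (auto simp: fine_def)
    ultimately show ?thesis by (auto intro!: exI[of _ u] exI[of _ v])
  qed
  define q where "q = {(t, K) \<in> p. t \<in> N'}"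
  have q: "q \<subseteq> p" by (auto simp: q_def)
  then have q: "finite q" "q \<subseteq> p" using fin finite_subset by blast+
  let ?\<Delta> = "\<lambda>(t, K). F (Sup K) - F (Inf K)"
  have out: "sum ?\<Delta> (p - q) \<le> (\<Sum>(t,K)\<in>p - q. \<epsilon> * (Sup K - Inf K))"
  proof (rule sum_mono, clarify)
    fix t K assume tK: "(t, K) \<in> p" "(t, K) \<notin> q"
    then have "t \<notin> N'" by (auto simp: q_def)
    moreover obtain u v where "K = {u..v}" "a \<le> u" "u \<le> t" "t \<le> v" "v \<le> b" "{u..v} \<subseteq> G t"
      using cell[OF tK(1)] by blast
    moreover from this have "u \<in> G t" "v \<in> G t" by auto
    ultimately show "F (Sup K) - F (Inf K) \<le> \<epsilon> * (Sup K - Inf K)"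
      using G(4)[of t u v] by auto
  qed
  also have "\<dots> \<le> (\<Sum>(t,K)\<in>p. \<epsilon> * (Sup K - Inf K))"
  proof (rule sum_mono2[OF fin])
    show "p - q \<subseteq> p" by auto
    fix z assume "z \<in> p - (p - q)"
    then obtain t K where z: "z = (t, K)" "(t, K) \<in> p" by (cases z) auto
    then show "0 \<le> (case z of (t, K) \<Rightarrow> \<epsilon> * (Sup K - Inf K))"
      using cell[OF z(2)] \<epsilon> by auto
  qed
  also have "\<dots> = \<epsilon> * (\<Sum>(t,K)\<in>p. Sup K - Inf K)"
    by (simp add: sum_distrib_left case_prod_unfold)
  also have "\<dots> = \<epsilon> * (b - a)"
    using additive_tagged_division_1[OF \<open>a \<le> b\<close> p(1), of "\<lambda>x. x"] by simp
  finally have out: "sum ?\<Delta> (p - q) \<le> \<epsilon> * (b - a)" .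
  \<comment> \<open>Absolute continuity is stated for indexed families, so the exceptional cells are
    enumerated.\<close>
  obtain n :: nat and r where r: "bij_betw r {..<n} q"
    using ex_bij_betw_nat_finite[OF q(1)] by (auto simp: atLeast0LessThan)
  define u v where "u = (\<lambda>i. Inf (snd (r i)))" and "v = (\<lambda>i. Sup (snd (r i)))"
  have ri: "r i \<in> q" if "i < n" for i using r that by (auto simp: bij_betw_def)
  have uv: "snd (r i) = {u i..v i} \<and> a \<le> u i \<and> u i \<le> v i \<and> v i \<le> b \<and> {u i..v i} \<subseteq> U" if "i < n" for i
  proof -
    obtain t K where tK: "r i = (t, K)" by fastforce
    then have "(t, K) \<in> p" "t \<in> N'" using ri[OF that] by (auto simp: q_def)
    then obtain c d where "K = {c..d}" "a \<le> c" "c \<le> t" "t \<le> d" "d \<le> b" "{c..d} \<subseteq> U"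
      using cell[of t K] G(3)[of t] by blast
    then show ?thesis by (simp add: u_def v_def tK)
  qed
  have dis: "disjoint_family_on (\<lambda>i. {u i<..<v i}) {..<n}"
    unfolding disjoint_family_on_def
  proof (intro ballI impI)
    fix i j assume ij: "i \<in> {..<n}" "j \<in> {..<n}" "i \<noteq> j"
    then have "r i \<noteq> r j" using r by (auto simp: bij_betw_def inj_on_def)
    moreover have "r i \<in> p" "r j \<in> p" using ri q(2) ij by auto
    ultimately have "interior (snd (r i)) \<inter> interior (snd (r j)) = {}"
      using tagged_division_ofD(5)[OF p(1), of "fst (r i)" "snd (r i)" "fst (r j)" "snd (r j)"] by simp
    then show "{u i<..<v i} \<inter> {u j<..<v j} = {}"
      using uv[of i] uv[of j] ij by (simp add: interior_atLeastAtMost_real)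
  qed
  have "(\<Sum>i<n. v i - u i) = (\<Sum>i<n. measure lebesgue {u i<..<v i})"
    using uv by (intro sum.cong) auto
  also have "\<dots> = measure lebesgue (\<Union>i<n. {u i<..<v i})"
    using dis uv by (intro measure_finite_Union[symmetric]) auto
  also have "\<dots> \<le> measure lebesgue U"
    by (rule measure_mono_fmeasurable) (use uv U in fastforce)+
  finally have small: "(\<Sum>i<n. v i - u i) < \<delta>" using U(4) by simp
  have "sum ?\<Delta> q = (\<Sum>i<n. F (v i) - F (u i))"
    using sum.reindex_bij_betw[OF r, of ?\<Delta>] by (simp add: u_def v_def case_prod_unfold)
  also have "\<dots> \<le> (\<Sum>i<n. \<bar>F (v i) - F (u i)\<bar>)" by (intro sum_mono) auto
  also have "\<dots> < \<epsilon>" using \<delta>(2)[of n u v] uv dis small by auto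
  finally have inn: "sum ?\<Delta> q < \<epsilon>" .
  have "F b - F a = sum ?\<Delta> p" using additive_tagged_division_1[OF \<open>a \<le> b\<close> p(1), of F] by simp
  also have "\<dots> = sum ?\<Delta> (p - q) + sum ?\<Delta> q" using sum.subset_diff[OF q(2) fin] by simp
  also have "\<dots> \<le> \<epsilon> * (b - a) + \<epsilon>" using out inn by simp
  also have "\<dots> = \<epsilon> * (b - a + 1)" by (simp add: algebra_simps)
  also have "\<dots> = e" using \<open>a \<le> b\<close> by (simp add: \<epsilon>_def)
  finally show "F b \<le> F a + e" by simp
qed

section \<open>Barrier principles for absolutely continuous functions\<close>

lemma last_nonpos_point:
  fixes w :: "real \<Rightarrow> real"
  assumes cont: "continuous_on {a..b} w" and "a \<le> b" "w a \<le> 0"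
  obtains c where "a \<le> c" "c \<le> b" "w c \<le> 0" "\<And>t. c < t \<Longrightarrow> t \<le> b \<Longrightarrow> 0 < w t"
    "0 < w b \<Longrightarrow> w c = 0"
proof -
  define S where "S = {a..b} \<inter> w -` {..0}"
  have "closed S" unfolding S_def using cont by (intro continuous_closed_preimage) auto
  moreover have "bounded S" by (rule bounded_subset[of "{a..b}"]) (auto simp: S_def)
  ultimately have S: "compact S" "a \<in> S" using assms by (auto simp: compact_eq_bounded_closed S_def)
  then obtain c where c: "c \<in> S" "\<And>t. t \<in> S \<Longrightarrow> t \<le> c"
    using compact_attains_sup[of S] by auto
  have pos: "0 < w t" if "c < t" "t \<le> b" for t
    using c(1) c(2)[of t] that by (fastforce simp: S_def)
  \<comment> \<open>The intermediate value theorem gives a zero in \<open>[c, b]\<close>; it can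
    only be \<open>c\<close>, since \<open>w\<close> is positive beyond \<open>c\<close>.\<close>
  have "w c = 0" if "0 < w b"
  proof -
    have "\<exists>t\<ge>c. t \<le> b \<and> w t = 0"
      using c(1) that by (intro IVT' continuous_on_subset[OF cont]) (auto simp: S_def)
    then show ?thesis using pos by force
  qed
  then show ?thesis using that[of c] c(1) pos by (auto simp: S_def)
qed

text \<open>The sign of the derivative matters only where \<open>w\<close> is positive: past its
  last nonpositive point \<open>w\<close> is positive, hence nonincreasing up to
  \<open>b\<close>.\<close>

lemma abs_continuous_barrier:
  assumes ac: "abs_continuous_on_interval a b w" and "a \<le> b" and N: "negligible N" and "w a \<le> 0"
    and deriv: "\<And>t. t \<in> {a<..<b} - N \<Longrightarrow> 0 < w t \<Longrightarrow> \<exists>D\<le>0. (w has_real_derivative D) (at t)"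
  shows "w b \<le> 0"
proof -
  obtain c where c: "a \<le> c" "c \<le> b" "w c \<le> 0" "\<And>t. c < t \<Longrightarrow> t \<le> b \<Longrightarrow> 0 < w t"
    using last_nonpos_point[OF abs_continuous_on_interval_imp_continuous_on[OF ac] assms(2,4)] by metis
  have "w b \<le> w c"
    by (rule abs_continuous_nonincreasing[OF abs_continuous_on_interval_subset[OF ac, of c b] _ N])
      (use c deriv in auto)
  then show ?thesis using c(3) by simp
qed

text \<open>Reflecting time turns the last nonpositive point into the first one, \<open>- c\<close>.
  Before it \<open>w\<close> is positive, so \<open>- w\<close> is nonincreasing on
  \<open>[a, - c]\<close>.\<close>

lemma abs_continuous_barrier_backward:
  assumes ac: "abs_continuous_on_interval a b w" and "a \<le> b" and N: "negligible N" and "w b \<le> 0"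
    and deriv: "\<And>t. t \<in> {a<..<b} - N \<Longrightarrow> 0 < w t \<Longrightarrow> \<exists>D\<ge>0. (w has_real_derivative D) (at t)"
  shows "w a \<le> 0"
proof -
  have "continuous_on {- b..- a} (\<lambda>t. w (- t))"
    by (intro continuous_on_compose2[OF abs_continuous_on_interval_imp_continuous_on[OF ac]]
        continuous_intros) auto
  then obtain c where c: "- b \<le> c" "c \<le> - a" "w (- c) \<le> 0"
      "\<And>t. c < t \<Longrightarrow> t \<le> - a \<Longrightarrow> 0 < w (- t)"
    using last_nonpos_point[of "- b" "- a" "\<lambda>t. w (- t)"] assms(2,4) by auto
  have "- w (- c) \<le> - w a"
  proof (rule abs_continuous_nonincreasing[where F = "\<lambda>t. - w t", OF abs_continuous_on_interval_minus _ N])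
    show "abs_continuous_on_interval a (- c) w"
      using c by (intro abs_continuous_on_interval_subset[OF ac]) auto
  next
    fix t assume t: "t \<in> {a<..<- c} - N"
    then have "0 < w t" using c(4)[of "- t"] by auto
    moreover have "t \<in> {a<..<b} - N" using t c by auto
    ultimately obtain D where "D \<ge> 0" "(w has_real_derivative D) (at t)" using deriv by blast
    then show "\<exists>D\<le>0. ((\<lambda>t. - w t) has_real_derivative D) (at t)"
      by (intro exI[of _ "- D"]) (auto intro: DERIV_minus)
  qed (use c in auto)
  then show ?thesis using c(3) by simp
qed

subsection \<open>Differential inequalities with bounded delay\<close>

text \<open>Here \<open>\<sigma>\<close> is \<open>a0\<close> times the time since the zero,
  \<open>\<tau>\<close> stands for \<open>A * H\<close>, and \<open>s\<close> is the value of
  \<open>\<sigma>\<close> at which \<open>q * (exp (\<tau> - \<sigma>) - 1)\<close> has fallen to 1.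
  Written in \<open>w\<close>, and with the logarithm replaced by a tangent bound, the profile is at
  most \<open>1 - c / w\<close>; then \<open>0 \<le> c\<close> and \<open>w \<le> 1\<close>
  suffice.\<close>

lemma forward_profile_bound:
  fixes q \<tau> \<sigma> :: real
  defines "L \<equiv> ln ((q\<^sup>2 + q) / (q\<^sup>2 + 1))" and "s \<equiv> \<tau> - ln ((q + 1) / q)"
  assumes q: "0 < q" and \<sigma>: "\<sigma> \<le> \<tau>" and L: "q * L \<le> exp (- \<tau>)"
  shows "q * (exp (- \<sigma>) * (exp s - 1) + q * (exp (\<tau> - \<sigma>) * (\<sigma> - s) - 1 + exp (s - \<sigma>)))
    \<le> 1 - q * (exp (- \<tau>) - q * L)"
proof -
  define w v c where "w = exp (\<sigma> - \<tau>)" and "v = exp (- \<tau>)" and "c = q * (v - q * L)"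
  have w: "0 < w" "w \<le> 1" using \<sigma> by (auto simp: w_def)
  have c: "0 \<le> c" using L q by (auto simp: c_def v_def)
  have pos: "0 < q\<^sup>2" "0 < q\<^sup>2 + 1" using q by (auto intro: add_pos_pos)
  have s: "exp s = exp \<tau> * (q / (q + 1))" using q by (simp add: s_def exp_diff)
  have e1: "exp (- \<sigma>) = v / w" "exp (\<tau> - \<sigma>) = 1 / w"
    by (simp_all add: v_def w_def exp_minus exp_diff field_simps)
  have e2: "v / w * exp s = q / (q + 1) / w" "exp (s - \<sigma>) = q / (q + 1) / w"
    by (simp_all add: s exp_diff v_def w_def exp_minus field_simps)
  \<comment> \<open>The factor \<open>(q\<^sup>2 + 1) / q\<^sup>2\<close> is chosen so that
    splitting the logarithm leaves exactly \<open>L\<close>, and the tangent bound turns the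
    numerator into \<open>w - c\<close>.\<close>
  have "ln (w * ((q\<^sup>2 + 1) / q\<^sup>2)) \<le> w * ((q\<^sup>2 + 1) / q\<^sup>2) - 1"
    using w pos by (intro ln_le_minus_one mult_pos_pos divide_pos_pos) auto
  moreover have "\<sigma> - s = ln (w * ((q\<^sup>2 + 1) / q\<^sup>2)) + L"
  proof -
    have "ln (w * ((q\<^sup>2 + 1) / q\<^sup>2)) + L = ln (w * ((q\<^sup>2 + 1) / q\<^sup>2) * ((q\<^sup>2 + q) / (q\<^sup>2 + 1)))"
      unfolding L_def using w pos q by (intro ln_mult_pos[symmetric] mult_pos_pos divide_pos_pos add_pos_pos) auto
    also have "w * ((q\<^sup>2 + 1) / q\<^sup>2) * ((q\<^sup>2 + q) / (q\<^sup>2 + 1)) = w * ((q\<^sup>2 + q) / q\<^sup>2)"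
      using pos by simp
    also have "(q\<^sup>2 + q) / q\<^sup>2 = (q + 1) / q"
      using q by (simp add: field_simps power2_eq_square)
    also have "ln (w * ((q + 1) / q)) = ln w + ln ((q + 1) / q)"
      using w q by (intro ln_mult_pos divide_pos_pos) auto
    finally show ?thesis by (simp add: s_def w_def)
  qed
  ultimately have ln_le: "\<sigma> - s \<le> w * ((q\<^sup>2 + 1) / q\<^sup>2) - 1 + L" by simp
  have e3: "exp (- \<sigma>) * (exp s - 1) = (q / (q + 1) - v) / w"
    unfolding e1 right_diff_distrib e2 by (simp add: diff_divide_distrib)
  have "q * ((a - v) / w + q * (1 / w * y - 1 + a / w)) = (q * (a - v) + q\<^sup>2 * (y - w + a)) / w" for a y
    using w by (simp add: field_simps power2_eq_square)
  then have "q * (exp (- \<sigma>) * (exp s - 1) + q * (exp (\<tau> - \<sigma>) * (\<sigma> - s) - 1 + exp (s - \<sigma>)))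
      = (q * (q / (q + 1) - v) + q\<^sup>2 * (\<sigma> - s - w + q / (q + 1))) / w"
    unfolding e1(2) e2(2) e3 .
  also have "\<dots> \<le> (q * (q / (q + 1) - v) + q\<^sup>2 * (w * ((q\<^sup>2 + 1) / q\<^sup>2) - 1 + L - w + q / (q + 1))) / w"
    using ln_le w q by (intro divide_right_mono add_left_mono mult_left_mono) auto
  also have "q * (q / (q + 1) - v) + q\<^sup>2 * (w * ((q\<^sup>2 + 1) / q\<^sup>2) - 1 + L - w + q / (q + 1)) = w - c"
  proof -
    have "q * r + q\<^sup>2 * r = q * (r * (q + 1))" for r
      by (simp add: algebra_simps power2_eq_square)
    from this[of "q / (q + 1)"] have "q * (q / (q + 1)) + q\<^sup>2 * (q / (q + 1)) = q\<^sup>2"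
      using q by (simp add: power2_eq_square)
    moreover have "q\<^sup>2 * (w * ((q\<^sup>2 + 1) / q\<^sup>2)) = w * (q\<^sup>2 + 1)" using q by simp
    ultimately show ?thesis by (simp add: c_def algebra_simps power2_eq_square)
  qed
  also have "(w - c) / w \<le> 1 - c"
    using w c mult_right_mono[of w 1 c] by (simp add: field_simps)
  finally show ?thesis by (simp add: c_def v_def)
qed

text \<open>The right-hand side bound merges the two signs of \<open>x t\<close>: the term is \<open>- a0 * x t\<close> for
  \<open>x t \<ge> 0\<close> and \<open>- A * x t\<close> for \<open>x t \<le> 0\<close>, the worst cases for an upper bound on the derivative.\<close>
locale delay_inequality =
  fixes a0 A b0 H T :: real and N :: "real set" and x :: "real \<Rightarrow> real"
  assumes coeffs: "0 < a0" "a0 \<le> A" "0 < b0" "0 < H"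
    and abs_cont: "\<And>a b. T \<le> a \<Longrightarrow> abs_continuous_on_interval a b x"
    and negligible: "negligible N"
    and deriv: "\<And>t. T \<le> t \<Longrightarrow> t \<notin> N \<Longrightarrow> \<exists>D. (x has_real_derivative D) (at t) \<and>
      (\<forall>\<nu>\<ge>0. (\<forall>s\<in>{t - H..t}. - \<nu> \<le> x s) \<longrightarrow> D \<le> b0 * \<nu> - a0 * max (x t) 0 - A * min (x t) 0)"
begin

text \<open>The barrier is applied to \<open>x - z\<close>. The delayed bound \<open>\<nu>\<close>
  may be chosen anew at each time, and is needed only where \<open>x\<close> exceeds
  \<open>z\<close>.\<close>

lemma comparison:
  assumes "T \<le> c" "c \<le> d"
    and z: "\<And>s. c \<le> s \<Longrightarrow> s \<le> d \<Longrightarrow> (z has_real_derivative z' s) (at s)" "continuous_on {c..d} z'"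
    and "x c \<le> z c"
    and step: "\<And>s. \<lbrakk>c < s; s < d; z s < x s\<rbrakk> \<Longrightarrow> \<exists>\<nu>\<ge>0. (\<forall>r\<in>{s - H..s}. - \<nu> \<le> x r) \<and>
        b0 * \<nu> - a0 * max (x s) 0 - A * min (x s) 0 \<le> z' s"
  shows "x d \<le> z d"
proof -
  have "x d - z d \<le> 0"
  proof (rule abs_continuous_barrier[where w = "\<lambda>s. x s - z s", OF _ \<open>c \<le> d\<close> negligible])
    show "abs_continuous_on_interval c d (\<lambda>s. x s - z s)"
      using assms by (intro abs_continuous_on_interval_diff abs_cont abs_continuous_on_interval_C1[OF _ z(2)]) auto
  next
    fix s assume s: "s \<in> {c<..<d} - N" "0 < x s - z s"
    obtain D where D: "(x has_real_derivative D) (at s)"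
      "\<And>\<nu>. \<lbrakk>0 \<le> \<nu>; \<forall>r\<in>{s - H..s}. - \<nu> \<le> x r\<rbrakk> \<Longrightarrow> D \<le> b0 * \<nu> - a0 * max (x s) 0 - A * min (x s) 0"
      using deriv[of s] s assms(1) by auto
    obtain \<nu> where "0 \<le> \<nu>" "\<forall>r\<in>{s - H..s}. - \<nu> \<le> x r"
        "b0 * \<nu> - a0 * max (x s) 0 - A * min (x s) 0 \<le> z' s"
      using step[of s] s by auto
    then have "D \<le> z' s" using D(2)[of \<nu>] by simp
    then show "\<exists>D\<le>0. ((\<lambda>s. x s - z s) has_real_derivative D) (at s)"
      using D(1) z(1)[of s] s by (intro exI[of _ "D - z' s"]) (auto intro: DERIV_diff)
  qed (use assms in auto)
  then show ?thesis by simp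
qed

lemma nonincreasing:
  assumes "T \<le> c" "c \<le> d" and nonneg: "\<And>s. c - H \<le> s \<Longrightarrow> s \<le> d \<Longrightarrow> 0 \<le> x s"
  shows "x d \<le> x c"
proof (rule comparison[where z = "\<lambda>_. x c" and z' = "\<lambda>_. 0", OF assms(1,2)])
  fix s assume s: "c < s" "s < d"
  then show "\<exists>\<nu>\<ge>0. (\<forall>r\<in>{s - H..s}. - \<nu> \<le> x r) \<and> b0 * \<nu> - a0 * max (x s) 0 - A * min (x s) 0 \<le> 0"
    using nonneg coeffs by (intro exI[of _ 0]) auto
qed auto

text \<open>From \<open>S + H\<close> on the whole delay window is positive, so
  \<open>\<nu> = 0\<close> is admissible and \<open>x\<close> stays below a solution of
  \<open>z' = - a0 * z\<close>.\<close>

lemma eventually_positive_tendsto_0: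
  assumes "T \<le> S" and pos: "\<And>t. S \<le> t \<Longrightarrow> 0 < x t"
  shows "(x \<longlongrightarrow> 0) at_top"
proof (rule tendsto_sandwich)
  define c where "c = S + H"
  show "eventually (\<lambda>t. 0 \<le> x t) at_top"
    using pos by (auto simp: eventually_at_top_linorder intro!: exI[of _ S] less_imp_le)
  have "x d \<le> x c * exp (- a0 * (d - c))" if "c \<le> d" for d
  proof (rule comparison[where z = "\<lambda>s. x c * exp (- a0 * (s - c))"
        and z' = "\<lambda>s. - a0 * (x c * exp (- a0 * (s - c)))", OF _ that])
    fix s assume s: "c < s" "s < d" "x c * exp (- a0 * (s - c)) < x s"
    have "b0 * 0 - a0 * max (x s) 0 - A * min (x s) 0 \<le> - a0 * (x c * exp (- a0 * (s - c)))"
      using s pos[of s] coeffs by (auto simp: c_def)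
    moreover have "\<forall>r\<in>{s - H..s}. - 0 \<le> x r"
      using s pos by (auto simp: c_def intro!: less_imp_le)
    ultimately show "\<exists>\<nu>\<ge>0. (\<forall>r\<in>{s - H..s}. - \<nu> \<le> x r) \<and>
        b0 * \<nu> - a0 * max (x s) 0 - A * min (x s) 0 \<le> - a0 * (x c * exp (- a0 * (s - c)))"
      by blast
  qed (use assms coeffs in \<open>auto simp: c_def intro!: derivative_eq_intros continuous_intros\<close>)
  then show "eventually (\<lambda>t. x t \<le> x c * exp (- a0 * (t - c))) at_top"
    by (auto simp: eventually_at_top_linorder)
  show "((\<lambda>t. x c * exp (- a0 * (t - c))) \<longlongrightarrow> 0) at_top"
    using coeffs(1) by real_asymp
qed simp

text \<open>A violation of the bound forces \<open>x < 0\<close>, where the undelayed term is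
  \<open>- A * x t\<close>; this produces the rate \<open>A\<close>. The distance \<open>H\<close>
  from \<open>S\<close> keeps the delay windows in the region where
  \<open>- \<mu> \<le> x\<close>.\<close>

lemma backward_bound:
  assumes "T \<le> S" and \<mu>: "0 \<le> \<mu>" "\<And>s. S \<le> s \<Longrightarrow> - \<mu> \<le> x s"
    and "S + H \<le> u" "u \<le> \<xi>" "x \<xi> = 0"
  shows "- x u \<le> b0 / A * \<mu> * (exp (A * (\<xi> - u)) - 1)"
proof -
  have A: "0 < A" using coeffs by simp
  define B where "B = b0 / A * \<mu>"
  have B: "0 \<le> B" "A * B = b0 * \<mu>" using \<mu> coeffs A by (auto simp: B_def)
  \<comment> \<open>The weight \<open>exp (A * t)\<close> is an integrating factor. Without it the
    derivative of the difference is only bounded below by \<open>- A\<close> times the difference,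
    which is negative where the difference is positive.\<close>
  define w where "w = (\<lambda>t. (B - x t) * exp (A * t) - B * exp (A * \<xi>))"
  have w_eq: "w t = (- x t - B * (exp (A * (\<xi> - t)) - 1)) * exp (A * t)" for t
    by (simp add: w_def algebra_simps exp_diff)
  have "w u \<le> 0"
  proof (rule abs_continuous_barrier_backward[OF _ \<open>u \<le> \<xi>\<close> negligible])
    show "abs_continuous_on_interval u \<xi> w"
      unfolding w_def using assms coeffs
      by (intro abs_continuous_on_interval_diff abs_continuous_on_interval_mult abs_cont
          abs_continuous_on_interval_C1[of _ _ "\<lambda>_. _" "\<lambda>_. 0"]
          abs_continuous_on_interval_C1[of _ _ "\<lambda>t. exp (A * t)" "\<lambda>t. exp (A * t) * A"])
        (auto intro!: derivative_eq_intros continuous_intros)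
    show "w \<xi> \<le> 0" using assms by (simp add: w_def)
    fix t assume t: "t \<in> {u<..<\<xi>} - N" "0 < w t"
    then obtain D where D: "(x has_real_derivative D) (at t)"
      "\<And>\<nu>. \<lbrakk>0 \<le> \<nu>; \<forall>r\<in>{t - H..t}. - \<nu> \<le> x r\<rbrakk> \<Longrightarrow> D \<le> b0 * \<nu> - a0 * max (x t) 0 - A * min (x t) 0"
      using deriv[of t] assms(1,4) coeffs by auto
    have "0 < - x t - B * (exp (A * (\<xi> - t)) - 1)"
      using t(2) unfolding w_eq by (simp add: zero_less_mult_iff)
    moreover have "0 \<le> B * (exp (A * (\<xi> - t)) - 1)"
      using B A t by (intro mult_nonneg_nonneg) auto
    ultimately have "x t < 0" by simp
    moreover have "\<forall>r\<in>{t - H..t}. - \<mu> \<le> x r" using t assms by auto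
    ultimately have "D \<le> b0 * \<mu> - A * x t" using D(2)[of \<mu>] \<mu>(1) by simp
    then have "0 \<le> (- D + A * (B - x t)) * exp (A * t)"
      using B(2) by (intro mult_nonneg_nonneg) (auto simp: algebra_simps)
    moreover have "(w has_real_derivative (- D + A * (B - x t)) * exp (A * t)) (at t)"
      unfolding w_def using D(1)
      by (auto intro!: derivative_eq_intros simp: algebra_simps)
    ultimately show "\<exists>D\<ge>0. (w has_real_derivative D) (at t)" by blast
  qed
  then show ?thesis unfolding w_eq B_def by (simp add: mult_le_0_iff)
qed

text \<open>The comparison function solves \<open>z' = b0 * \<mu> - a0 * z\<close> with value 0 at
  \<open>\<xi>\<close>; wherever \<open>x\<close> exceeds it, \<open>x\<close> is positive and
  decays at least at rate \<open>a0\<close>.\<close>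

lemma forward_bound:
  assumes "T \<le> S" and \<mu>: "0 \<le> \<mu>" "\<And>s. S \<le> s \<Longrightarrow> - \<mu> \<le> x s"
    and "S + H \<le> \<xi>" "\<xi> \<le> t" "x \<xi> = 0"
  shows "x t \<le> b0 / a0 * \<mu> * (1 - exp (- a0 * (t - \<xi>)))"
proof (rule comparison[where z = "\<lambda>s. b0 / a0 * \<mu> * (1 - exp (- a0 * (s - \<xi>)))"
      and z' = "\<lambda>s. b0 * \<mu> * exp (- a0 * (s - \<xi>))", OF _ \<open>\<xi> \<le> t\<close>])
  fix s assume s: "\<xi> < s" "s < t" "b0 / a0 * \<mu> * (1 - exp (- a0 * (s - \<xi>))) < x s"
  have "0 \<le> b0 / a0 * \<mu> * (1 - exp (- a0 * (s - \<xi>)))"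
    using s \<mu> coeffs by (intro mult_nonneg_nonneg) (auto simp: mult_le_0_iff)
  then have "0 < x s" using s by simp
  moreover have "a0 * (b0 / a0 * \<mu> * (1 - exp (- a0 * (s - \<xi>)))) \<le> a0 * x s"
    using s coeffs by (intro mult_left_mono) auto
  then have "b0 * \<mu> - b0 * \<mu> * exp (- a0 * (s - \<xi>)) \<le> a0 * x s"
    using coeffs by (simp add: algebra_simps)
  ultimately show "\<exists>\<nu>\<ge>0. (\<forall>r\<in>{s - H..s}. - \<nu> \<le> x r) \<and>
      b0 * \<nu> - a0 * max (x s) 0 - A * min (x s) 0 \<le> b0 * \<mu> * exp (- a0 * (s - \<xi>))"
    using \<mu> s assms by (intro exI[of _ \<mu>]) (auto simp: algebra_simps)
qed (use assms coeffs in \<open>auto intro!: derivative_eq_intros continuous_intros\<close>)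

text \<open>\<open>z \<mu> (a0 * (t - \<xi>))\<close> solves, as a function of \<open>t\<close>, \<open>z' = - a0 * z + b0 * \<nu>\<close> for the delayed bound
  \<open>\<nu> s = q * \<mu> * (exp (A * H - a0 * (s - \<xi>)) - 1)\<close> and agrees at time \<open>\<xi> + s0 / a0\<close> with the profile
  obtained from the crude delayed bound \<open>\<mu>\<close>.\<close>
lemma refined_forward_bound:
  fixes s0 :: real
  defines "q \<equiv> b0 / a0"
  defines "z \<equiv> \<lambda>\<mu> \<sigma>. \<mu> * (q * (exp (- \<sigma>) * (exp s0 - 1) +
      q * (exp (A * H - \<sigma>) * (\<sigma> - s0) - 1 + exp (s0 - \<sigma>))))"
  assumes "T \<le> S" and \<mu>: "0 \<le> \<mu>" "\<And>s. S \<le> s \<Longrightarrow> - \<mu> \<le> x s"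
    and \<xi>: "S + 2 * H \<le> \<xi>" "x \<xi> = 0" and t: "t \<le> \<xi> + H" "\<And>s. \<xi> < s \<Longrightarrow> s \<le> t \<Longrightarrow> 0 < x s"
    and s0: "0 \<le> s0" "s0 \<le> a0 * (t - \<xi>)"
  shows "x t \<le> z \<mu> (a0 * (t - \<xi>))"
proof -
  \<comment> \<open>The actual time that corresponds to the rescaled time \<open>s0\<close>; here
    the crude profile hands over to the refined one.\<close>
  define c where "c = \<xi> + s0 / a0"
  have c: "\<xi> \<le> c" "c \<le> t" "a0 * (c - \<xi>) = s0"
    using s0 coeffs by (auto simp: c_def field_simps)
  have q: "0 < q" using coeffs by (simp add: q_def)
  have z_c: "z \<mu> s0 = q * \<mu> * (1 - exp (- s0))"
    by (simp add: z_def algebra_simps exp_minus)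
  define z' where "z' = (\<lambda>s. b0 * (q * \<mu> * (exp (A * H - a0 * (s - \<xi>)) - 1)) - a0 * z \<mu> (a0 * (s - \<xi>)))"
  show ?thesis
  proof (rule comparison[where z = "\<lambda>s. z \<mu> (a0 * (s - \<xi>))" and z' = z', OF _ \<open>c \<le> t\<close>])
    show "T \<le> c" using c \<xi> coeffs \<open>T \<le> S\<close> by simp
    show "((\<lambda>s. z \<mu> (a0 * (s - \<xi>))) has_real_derivative z' s) (at s)" for s
    proof -
      have "b0 = a0 * q" using coeffs by (simp add: q_def)
      then show ?thesis unfolding z'_def z_def
        by (auto intro!: derivative_eq_intros simp: algebra_simps)
    qed
    show "continuous_on {c..t} z'" unfolding z'_def z_def by (intro continuous_intros)
    show "x c \<le> z \<mu> (a0 * (c - \<xi>))"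
      using forward_bound[OF \<open>T \<le> S\<close> \<mu>, of \<xi> c] c \<xi> coeffs
      by (simp add: z_c q_def flip: mult_minus_left)
  next
    fix s assume s: "c < s" "s < t" "z \<mu> (a0 * (s - \<xi>)) < x s"
    define \<nu> where "\<nu> = q * \<mu> * (exp (A * H - a0 * (s - \<xi>)) - 1)"
    have "a0 * (s - \<xi>) \<le> a0 * H" using s t coeffs by (intro mult_left_mono) auto
    also have "\<dots> \<le> A * H" using coeffs by (intro mult_right_mono) auto
    finally have \<nu>: "0 \<le> \<nu>" using q \<mu> by (auto simp: \<nu>_def)
    have "- \<nu> \<le> x r" if r: "s - H \<le> r" "r \<le> s" for r
    proof (cases "\<xi> \<le> r")
      case True
      then have "0 \<le> x r" using t(2)[of r] \<xi>(2) s r by (cases "r = \<xi>") auto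
      then show ?thesis using \<nu> by simp
    next
      case False
      \<comment> \<open>Before the zero, \<open>\<xi> - r \<le> H - (s - \<xi>)\<close>. Weakening
        \<open>A * (s - \<xi>)\<close> to \<open>a0 * (s - \<xi>)\<close> and \<open>b0 / A\<close>
        to \<open>q\<close> makes the backward bound a function of rescaled time only.\<close>
      have "A * (\<xi> - r) \<le> A * (H - (s - \<xi>))" using r coeffs by (intro mult_left_mono) auto
      moreover have "a0 * (s - \<xi>) \<le> A * (s - \<xi>)" using s c coeffs by (intro mult_right_mono) auto
      ultimately have "exp (A * (\<xi> - r)) \<le> exp (A * H - a0 * (s - \<xi>))"
        by (simp add: algebra_simps)
      moreover have "b0 / A \<le> q" using coeffs by (simp add: q_def frac_le)
      moreover have "- x r \<le> b0 / A * \<mu> * (exp (A * (\<xi> - r)) - 1)"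
        using False r s c \<xi> coeffs by (intro backward_bound[OF \<open>T \<le> S\<close> \<mu>]) auto
      moreover have "1 \<le> exp (A * (\<xi> - r))" using False coeffs by simp
      ultimately have "- x r \<le> \<nu>"
        unfolding \<nu>_def using \<mu> q
        by (elim order_trans) (intro mult_mono mult_right_mono mult_nonneg_nonneg; simp)
      then show ?thesis by simp
    qed
    moreover have "b0 * \<nu> - a0 * max (x s) 0 - A * min (x s) 0 \<le> z' s"
      using t(2)[of s] s c coeffs by (auto simp: z'_def \<nu>_def)
    ultimately show "\<exists>\<nu>\<ge>0. (\<forall>r\<in>{s - H..s}. - \<nu> \<le> x r) \<and>
        b0 * \<nu> - a0 * max (x s) 0 - A * min (x s) 0 \<le> z' s"
      using \<nu> by (intro exI[of _ \<nu>]) auto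
  qed
qed

text \<open>Time is counted from the last zero before \<open>t\<close>. Two delay lengths after
  \<open>S\<close> are required: one for the window reaching back from beyond the zero, and one more
  for the backward bound inside that window.\<close>

lemma contraction:
  fixes q \<kappa> :: real
  defines "q \<equiv> b0 / a0"
  defines "\<kappa> \<equiv> 1 - q * (exp (- (A * H)) - q * ln ((q\<^sup>2 + q) / (q\<^sup>2 + 1)))"
  assumes H_large: "(q + 1) / q \<le> exp (A * H)"
    and L: "q * ln ((q\<^sup>2 + q) / (q\<^sup>2 + 1)) \<le> exp (- (A * H))"
    and "T \<le> S" and \<mu>: "0 \<le> \<mu>" "\<And>s. S \<le> s \<Longrightarrow> - \<mu> \<le> x s"
    and \<xi>: "S + 2 * H \<le> \<xi>" "\<xi> \<le> t" "x \<xi> = 0"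
  shows "0 \<le> \<kappa>" "x t \<le> \<kappa> * \<mu>"
proof -
  have q: "0 < q" using coeffs by (simp add: q_def)
  \<comment> \<open>Chosen so that \<open>q * (exp (A * H - s0) - 1) = 1\<close>: there the refined
    delayed bound has dropped to the crude bound \<open>\<mu>\<close>. The assumption
    \<open>H_large\<close> amounts to \<open>0 \<le> s0\<close>.\<close>
  define s0 where "s0 = A * H - ln ((q + 1) / q)"
  have "ln ((q + 1) / q) \<le> ln (exp (A * H))"
    using H_large q by (subst ln_le_cancel_iff) auto
  then have s0: "0 \<le> s0" "s0 \<le> A * H" using q by (auto simp: s0_def)
  have profile: "q * (exp (- \<sigma>) * (exp s0 - 1) + q * (exp (A * H - \<sigma>) * (\<sigma> - s0) - 1 + exp (s0 - \<sigma>))) \<le> \<kappa>"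
    if "\<sigma> \<le> A * H" for \<sigma>
    unfolding \<kappa>_def s0_def using forward_profile_bound[OF q that L] .
  \<comment> \<open>At \<open>\<sigma> = s0\<close> the refined part vanishes, so the same estimate
    also covers the crude profile, which is largest at its end.\<close>
  have "q * (exp (- s0) * (exp s0 - 1)) \<le> \<kappa>" using profile[OF s0(2)] by simp
  then have first: "q * (1 - exp (- s0)) \<le> \<kappa>" by (simp add: algebra_simps exp_minus)
  moreover have "0 \<le> q * (1 - exp (- s0))" using q s0 by simp
  ultimately show \<kappa>: "0 \<le> \<kappa>" by simp
  have near: "x r \<le> \<kappa> * \<mu>"
    if c: "S + 2 * H \<le> c" "x c = 0" and r: "c \<le> r" "r \<le> c + H" and pos: "\<And>s. c < s \<Longrightarrow> s \<le> r \<Longrightarrow> 0 < x s"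
    for c r
  proof (cases "a0 * (r - c) \<le> s0")
    case True
    have "x r \<le> q * \<mu> * (1 - exp (- a0 * (r - c)))"
      unfolding q_def using c r coeffs by (intro forward_bound[OF \<open>T \<le> S\<close> \<mu>]) auto
    also have "\<dots> \<le> q * \<mu> * (1 - exp (- s0))"
      using True q \<mu> by (intro mult_left_mono) auto
    also have "\<dots> = q * (1 - exp (- s0)) * \<mu>" by simp
    also have "\<dots> \<le> \<kappa> * \<mu>" using first \<mu> by (intro mult_right_mono)
    finally show ?thesis .
  next
    case False
    have "a0 * (r - c) \<le> a0 * H" using r coeffs by (intro mult_left_mono) auto
    also have "\<dots> \<le> A * H" using coeffs by (intro mult_right_mono) auto
    finally have \<sigma>: "a0 * (r - c) \<le> A * H" .
    have "x r \<le> \<mu> * (q * (exp (- (a0 * (r - c))) * (exp s0 - 1) + q * (exp (A * H - a0 * (r - c)) * (a0 * (r - c) - s0)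
        - 1 + exp (s0 - a0 * (r - c)))))"
      unfolding q_def
      by (rule refined_forward_bound[OF \<open>T \<le> S\<close> \<mu> c r(2) pos s0(1)]) (use False in auto)
    also have "\<dots> \<le> \<mu> * \<kappa>" using profile[OF \<sigma>] \<mu> by (intro mult_left_mono)
    finally show ?thesis by (simp add: mult.commute)
  qed
  show "x t \<le> \<kappa> * \<mu>"
  proof (cases "0 < x t")
    case False
    then show ?thesis using \<kappa> \<mu> by (meson mult_nonneg_nonneg not_less order_trans)
  next
    case True
    have "T \<le> \<xi>" using \<xi> \<open>T \<le> S\<close> coeffs by simp
    then obtain c where c: "\<xi> \<le> c" "c \<le> t" "\<And>s. c < s \<Longrightarrow> s \<le> t \<Longrightarrow> 0 < x s" "x c = 0"
      using last_nonpos_point[OF abs_continuous_on_interval_imp_continuous_on[OF abs_cont], of \<xi> t] \<xi> True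
      by (metis order_refl)
    show ?thesis
    proof (cases "t \<le> c + H")
      case True
      then show ?thesis using c \<xi> by (intro near[of c t]) auto
    next
      case False
      \<comment> \<open>Beyond \<open>c + H\<close> the delay window lies in \<open>[c, t]\<close>,
        where \<open>x\<close> is nonnegative, so \<open>x\<close> can only decrease.\<close>
      have "0 \<le> x s" if "c \<le> s" "s \<le> t" for s using c(3)[of s] c(4) that by (cases "s = c") auto
      then have "x t \<le> x (c + H)"
        using False c \<xi> \<open>T \<le> S\<close> coeffs by (intro nonincreasing) auto
      also have "\<dots> \<le> \<kappa> * \<mu>" using False c \<xi> coeffs by (intro near[of c]) auto
      finally show ?thesis .
    qed
  qed
qed

end

text \<open>Either the sign is eventually fixed and the decay is exponential, or zeros occur
  arbitrarily late and the contraction for \<open>x\<close> and \<open>- x\<close> shrinks the bound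
  by \<open>\<kappa>\<close> each time. Strictness of \<open>L\<close> gives
  \<open>\<kappa> < 1\<close>.\<close>

lemma two_sided_delay_inequality_tendsto_0:
  assumes up: "delay_inequality a0 A b0 H T N x" and down: "delay_inequality a0 A b0 H T N (\<lambda>t. - x t)"
    and bound: "\<And>t. T \<le> t \<Longrightarrow> \<bar>x t\<bar> \<le> M"
    and H_large: "(b0 / a0 + 1) / (b0 / a0) \<le> exp (A * H)"
    and L: "b0 / a0 * ln (((b0 / a0)\<^sup>2 + b0 / a0) / ((b0 / a0)\<^sup>2 + 1)) < exp (- (A * H))"
  shows "(x \<longlongrightarrow> 0) at_top"
proof -
  interpret up: delay_inequality a0 A b0 H T N x by (rule up)
  interpret down: delay_inequality a0 A b0 H T N "\<lambda>t. - x t" by (rule down)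
  define q where "q = b0 / a0"
  define \<kappa> where "\<kappa> = 1 - q * (exp (- (A * H)) - q * ln ((q\<^sup>2 + q) / (q\<^sup>2 + 1)))"
  have q: "0 < q" using up.coeffs by (simp add: q_def)
  have M: "0 \<le> M" using bound[of T] by simp
  show ?thesis
  proof (cases "\<exists>S. \<forall>t\<ge>S. x t \<noteq> 0")
    case True
    then obtain S where S: "T \<le> S" "\<And>t. S \<le> t \<Longrightarrow> x t \<noteq> 0"
      by (metis max.bounded_iff max.cobounded1)
    have cont: "continuous_on {S..t} x" for t
      using abs_continuous_on_interval_imp_continuous_on[OF up.abs_cont[OF S(1)]] .
    show ?thesis
    proof (cases "0 < x S")
      case True
      have "0 < x t" if "S \<le> t" for t
        using IVT2'[of x t 0 S] that True S(2) cont[of t] by force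
      then show ?thesis using up.eventually_positive_tendsto_0[OF S(1)] by blast
    next
      case False
      have "0 < - x t" if "S \<le> t" for t
        using IVT'[of x S 0 t] that False S(2)[of t] S(2) cont[of t] by force
      then have "((\<lambda>t. - x t) \<longlongrightarrow> 0) at_top" using down.eventually_positive_tendsto_0[OF S(1)] by blast
      then show ?thesis using tendsto_minus_cancel_left[of x 0 at_top] by simp
    qed
  next
    case False
    then have zeros: "\<exists>\<xi>\<ge>S. x \<xi> = 0" for S by blast
    have contract: "0 \<le> \<kappa> \<and> (\<exists>S'\<ge>T. \<forall>t\<ge>S'. \<bar>x t\<bar> \<le> \<kappa> * \<mu>)"
      if S: "T \<le> S" "\<forall>t\<ge>S. \<bar>x t\<bar> \<le> \<mu>" for S \<mu>
    proof -
      obtain \<xi> where \<xi>: "S + 2 * H \<le> \<xi>" "x \<xi> = 0" using zeros by blast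
      have \<mu>: "0 \<le> \<mu>" using S(2) by force
      have "x t \<le> \<kappa> * \<mu>" "- x t \<le> \<kappa> * \<mu>" "0 \<le> \<kappa>" if "\<xi> \<le> t" for t
        using up.contraction[OF H_large less_imp_le[OF L] S(1) \<mu> _ \<xi>(1) that \<xi>(2)]
          down.contraction[OF H_large less_imp_le[OF L] S(1) \<mu> _ \<xi>(1) that] S(2) \<xi>(2)
        unfolding \<kappa>_def q_def by (auto simp: abs_le_iff minus_le_iff)
      then show ?thesis using \<xi> S up.coeffs by (intro conjI exI[of _ \<xi>]) (auto simp: abs_le_iff)
    qed
    have iter: "\<exists>S\<ge>T. \<forall>t\<ge>S. \<bar>x t\<bar> \<le> \<kappa> ^ n * M" for n
    proof (induction n)
      case 0
      then show ?case using bound by auto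
    next
      case (Suc n)
      then obtain S where "T \<le> S" "\<forall>t\<ge>S. \<bar>x t\<bar> \<le> \<kappa> ^ n * M" by blast
      from contract[OF this] show ?case by (simp add: mult.assoc)
    qed
    have "0 \<le> \<kappa>" using contract[of T M] bound by blast
    moreover have "\<kappa> < 1"
    proof -
      have "0 < q * (exp (- (A * H)) - q * ln ((q\<^sup>2 + q) / (q\<^sup>2 + 1)))"
        using L unfolding q_def[symmetric] by (intro mult_pos_pos q) simp
      then show ?thesis by (simp add: \<kappa>_def)
    qed
    ultimately have "(\<lambda>n. \<kappa> ^ n * M) \<longlonglongrightarrow> 0 * M" by (intro tendsto_intros LIMSEQ_realpow_zero)
    show ?thesis
    proof (rule tendstoI)
      fix e :: real assume "0 < e"
      then obtain n where "\<kappa> ^ n * M < e"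
        using order_tendstoD(2)[OF \<open>(\<lambda>n. \<kappa> ^ n * M) \<longlonglongrightarrow> 0 * M\<close>, of e]
        by (auto simp: eventually_sequentially)
      then show "eventually (\<lambda>t. dist (x t) 0 < e) at_top"
        using iter[of n] by (fastforce simp: eventually_at_top_linorder)
    qed
  qed
qed

subsection \<open>The nonlinear equation\<close>

text \<open>If \<open>H\<close> exceeds \<open>h\<close>, then
  \<open>exp (- (A * H)) = q / (q + 1)\<close>, and
  \<open>L \<le> (q - 1) / (q\<^sup>2 + 1) < 1 / (q + 1)\<close> preserves the strict inequality for
  every positive \<open>q\<close>.\<close>

lemma enlarged_delay_condition:
  fixes q A h :: real
  defines "L \<equiv> ln ((q\<^sup>2 + q) / (q\<^sup>2 + 1))"
  assumes "0 < q" "0 < A" "q * L < exp (- (A * h))"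
  obtains H where "h \<le> H" "0 < H" "(q + 1) / q \<le> exp (A * H)" "q * L < exp (- (A * H))"
proof -
  define H where "H = max h (ln ((q + 1) / q) / A)"
  have "1 < (q + 1) / q" using assms by simp
  then have "0 < ln ((q + 1) / q) / A" using assms by (intro divide_pos_pos) auto
  then have H: "h \<le> H" "0 < H" by (auto simp: H_def)
  have "ln ((q + 1) / q) \<le> A * H"
    using assms by (auto simp: H_def max_def field_simps)
  then have "exp (ln ((q + 1) / q)) \<le> exp (A * H)" by simp
  then have "(q + 1) / q \<le> exp (A * H)" using \<open>1 < (q + 1) / q\<close> by simp
  moreover have "q * L < exp (- (A * H))"
  proof (cases "H = h")
    case False
    then have "A * H = ln ((q + 1) / q)" using assms by (auto simp: H_def max_def split: if_splits)
    then have e: "exp (- (A * H)) = q / (q + 1)" using assms by (simp add: exp_minus)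
    have p: "0 < q\<^sup>2 + 1" using assms by (auto intro: add_pos_pos)
    have "L \<le> (q\<^sup>2 + q) / (q\<^sup>2 + 1) - 1"
      unfolding L_def using assms p by (intro ln_le_minus_one divide_pos_pos add_pos_pos) auto
    also have "\<dots> = (q - 1) / (q\<^sup>2 + 1)" using p by (simp add: field_simps)
    also have "\<dots> < 1 / (q + 1)"
    proof -
      have "(q - 1) * (q + 1) < q\<^sup>2 + 1" by (simp add: algebra_simps power2_eq_square)
      then show ?thesis using p assms by (simp add: field_simps)
    qed
    finally have "q * L < q * (1 / (q + 1))" using assms by (intro mult_strict_left_mono)
    then show ?thesis by (simp add: e)
  qed (use assms in simp)
  ultimately show ?thesis using that H by blast
qed

theorem theorem5:
  fixes m :: nat
    and f :: "real \<Rightarrow> real \<Rightarrow> real"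
    and g :: "nat \<Rightarrow> real \<Rightarrow> real \<Rightarrow> real"
    and h :: "nat \<Rightarrow> real \<Rightarrow> real"
    and \<phi> x :: "real \<Rightarrow> real"
    and x10 x20 :: ereal
    and x1 x2 a0 A b0 h0 :: real
    and b :: "nat \<Rightarrow> real"
  assumes m: "1 \<le> m"
    and h_meas: "\<And>k. k \<in> {1..m} \<Longrightarrow> h k \<in> borel_measurable (lebesgue_on {0..})"
    and h_le: "\<And>k t. k \<in> {1..m} \<Longrightarrow> 0 \<le> t \<Longrightarrow> h k t \<le> t"
    and h_lim: "\<And>k. k \<in> {1..m} \<Longrightarrow> filterlim (h k) at_top at_top"
    and f_cont: "continuous_on ({0..} \<times> UNIV) (\<lambda>(t, u). f t u)"
    and g_cont: "\<And>k. k \<in> {1..m} \<Longrightarrow> continuous_on ({0..} \<times> UNIV) (\<lambda>(t, u). g k t u)"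
    and f_zero: "\<And>t. 0 \<le> t \<Longrightarrow> f t 0 = 0"
    and g_zero: "\<And>k t. k \<in> {1..m} \<Longrightarrow> 0 \<le> t \<Longrightarrow> g k t 0 = 0"
    and f_sign: "\<And>t u. 0 \<le> t \<Longrightarrow> u \<noteq> 0 \<Longrightarrow> f t u * u > 0"
    and g_sign: "\<And>k t u. k \<in> {1..m} \<Longrightarrow> 0 \<le> t \<Longrightarrow> u \<noteq> 0 \<Longrightarrow> g k t u * u > 0"
    and bounds0: "x10 \<le> 0" "0 \<le> x20"
    and bounds: "x1 \<le> 0" "0 \<le> x2"
    and wellposed: "\<And>\<psi>. initial_function_between x10 x20 \<psi> \<Longrightarrow>
          (\<exists>!y. is_solution m f g h \<psi> y) \<and>
          (\<forall>y. is_solution m f g h \<psi> y \<longrightarrow> (\<forall>t\<ge>0. x1 \<le> y t \<and> y t \<le> x2))"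
    and pos: "0 < a0" "0 < A" "\<And>k. k \<in> {1..m} \<Longrightarrow> 0 < b k"
    and f_bounds: "\<And>t u. 0 \<le> t \<Longrightarrow> x1 \<le> u \<Longrightarrow> u \<le> x2 \<Longrightarrow> u \<noteq> 0 \<Longrightarrow>
          a0 \<le> f t u / u \<and> f t u / u \<le> A"
    and g_bounds: "\<And>k t u. k \<in> {1..m} \<Longrightarrow> 0 \<le> t \<Longrightarrow> x1 \<le> u \<Longrightarrow> u \<le> x2 \<Longrightarrow> u \<noteq> 0 \<Longrightarrow>
          0 \<le> g k t u / u \<and> g k t u / u \<le> b k"
    and delay: "\<And>k t. k \<in> {1..m} \<Longrightarrow> 0 \<le> t \<Longrightarrow> t - h k t \<le> h0"
    and b0: "b0 = (\<Sum>k=1..m. b k)"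
    and main: "a0 / b0 * exp (- A * h0) > ln ((b0\<^sup>2 + a0 * b0) / (b0\<^sup>2 + a0\<^sup>2))"
    and phi: "initial_function_between x10 x20 \<phi>"
    and sol: "is_solution m f g h \<phi> x"
  shows "(x \<longlongrightarrow> 0) at_top"
proof -
  have x_bounds: "x1 \<le> x t" "x t \<le> x2" if "0 \<le> t" for t
    using wellposed[OF phi] sol that by auto
  show ?thesis
  \<comment> \<open>In the degenerate range there is no nonzero \<open>u\<close> from which to
    derive \<open>a0 \<le> A\<close>, but then the solution vanishes for
    \<open>t \<ge> 0\<close>.\<close>
  proof (cases "x1 = 0 \<and> x2 = 0")
    case True
    then have "\<forall>t\<ge>0. x t = 0" using x_bounds by force
    then show ?thesis by (intro tendsto_eventually) (auto simp: eventually_at_top_linorder)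
  next
    case False
    then obtain u where "u \<noteq> 0" "x1 \<le> u" "u \<le> x2"
      using bounds that[of x1] that[of x2] by auto
    then have "a0 \<le> A" using f_bounds[of 0 u] by simp
    have "0 < b 1" "\<And>k. k \<in> {1..m} \<Longrightarrow> 0 \<le> b k" using pos(3) m by (auto intro: less_imp_le)
    then have "0 < b0" unfolding b0 using m by (intro sum_pos2[of _ 1]) auto
    define q where "q = b0 / a0"
    have q: "0 < q" using \<open>0 < b0\<close> pos by (simp add: q_def)
    have "(b0\<^sup>2 + a0 * b0) / (b0\<^sup>2 + a0\<^sup>2) = (q\<^sup>2 + q) / (q\<^sup>2 + 1)"
    proof -
      have "b0 = a0 * q" using pos by (simp add: q_def)
      then have "b0\<^sup>2 + a0 * b0 = a0\<^sup>2 * (q\<^sup>2 + q)" "b0\<^sup>2 + a0\<^sup>2 = a0\<^sup>2 * (q\<^sup>2 + 1)"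
        by (simp_all add: algebra_simps power2_eq_square)
      then show ?thesis using pos by simp
    qed
    then have "ln ((q\<^sup>2 + q) / (q\<^sup>2 + 1)) < exp (- (A * h0)) / q"
      using main by (simp add: q_def mult.commute)
    then have "q * ln ((q\<^sup>2 + q) / (q\<^sup>2 + 1)) < exp (- (A * h0))"
      using q by (simp add: field_simps)
    then obtain H where H: "h0 \<le> H" "0 < H" "(q + 1) / q \<le> exp (A * H)"
        "q * ln ((q\<^sup>2 + q) / (q\<^sup>2 + 1)) < exp (- (A * H))"
      using enlarged_delay_condition[OF q pos(2)] by blast
    have "0 \<le> h0" using delay[of 1 0] h_le[of 1 0] m by simp
    have "AE t in lebesgue_on {0..}. \<exists>D. (x has_real_derivative D) (at t) \<and>
        D + f t (x t) + (\<Sum>k=1..m. g k t (x (h k t))) = 0"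
      using sol by (simp add: is_solution_def)
    then have "AE t in lebesgue. 0 \<le> t \<longrightarrow> (\<exists>D. (x has_real_derivative D) (at t) \<and>
        D + f t (x t) + (\<Sum>k=1..m. g k t (x (h k t))) = 0)"
      by (simp add: AE_restrict_space_iff)
    then obtain N where "N \<in> null_sets lebesgue"
      "{t. \<not> (0 \<le> t \<longrightarrow> (\<exists>D. (x has_real_derivative D) (at t) \<and>
        D + f t (x t) + (\<Sum>k=1..m. g k t (x (h k t))) = 0))} \<subseteq> N"
      unfolding eventually_ae_filter by auto
    then have N: "negligible N"
      "\<And>t. \<lbrakk>0 \<le> t; t \<notin> N\<rbrakk> \<Longrightarrow> \<exists>D. (x has_real_derivative D) (at t) \<and>
        D + f t (x t) + (\<Sum>k=1..m. g k t (x (h k t))) = 0"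
      by (auto simp: negligible_iff_null_sets)
    \<comment> \<open>Multiplying the quotient bounds by a negative \<open>x t\<close> reverses
      them, so \<open>a0\<close> and \<open>A\<close> trade places with the sign.\<close>
    have f_lower: "a0 * max (x t) 0 + A * min (x t) 0 \<le> f t (x t)"
      and f_upper: "f t (x t) \<le> A * max (x t) 0 + a0 * min (x t) 0" if "0 \<le> t" for t
      using f_bounds[OF that x_bounds[OF that]] f_zero[OF that]
      by (cases "x t" "0::real" rule: linorder_cases; auto simp: field_simps max_def min_def)+
    have g_lower: "- b k * \<nu> \<le> g k t (x s)" if "k \<in> {1..m}" "0 \<le> t" "0 \<le> s" "0 \<le> \<nu>" "- \<nu> \<le> x s" for k t s \<nu>
    proof (cases "x s" "0::real" rule: linorder_cases)
      case less
      then have "b k * x s \<le> g k t (x s)"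
        using g_bounds[OF that(1,2) x_bounds[OF that(3)]] by (auto simp: field_simps)
      moreover have "b k * - \<nu> \<le> b k * x s" using that pos(3)[of k] by (intro mult_left_mono) auto
      ultimately show ?thesis by simp
    next
      case equal
      then show ?thesis using g_zero that pos(3)[of k] by simp
    next
      case greater
      then have "0 \<le> g k t (x s)" using g_sign[of k t "x s"] that by (simp add: zero_less_mult_iff)
      moreover have "0 \<le> b k * \<nu>" using that pos(3)[of k] by simp
      ultimately show ?thesis by simp
    qed
    have g_upper: "g k t (x s) \<le> b k * \<nu>" if "k \<in> {1..m}" "0 \<le> t" "0 \<le> s" "0 \<le> \<nu>" "x s \<le> \<nu>" for k t s \<nu>
    proof (cases "x s" "0::real" rule: linorder_cases)
      case greater
      then have "g k t (x s) \<le> b k * x s"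
        using g_bounds[OF that(1,2) x_bounds[OF that(3)]] by (auto simp: field_simps)
      moreover have "b k * x s \<le> b k * \<nu>" using that pos(3)[of k] by (intro mult_left_mono) auto
      ultimately show ?thesis by simp
    next
      case equal
      then show ?thesis using g_zero that pos(3)[of k] by simp
    next
      case less
      then have "g k t (x s) \<le> 0" using g_sign[of k t "x s"] that by (simp add: zero_less_mult_iff)
      moreover have "0 \<le> b k * \<nu>" using that pos(3)[of k] by simp
      ultimately show ?thesis by simp
    qed
    \<comment> \<open>From \<open>h0\<close> on all delayed arguments are nonnegative, where
      \<open>x1 \<le> x \<le> x2\<close> is known; the initial function may violate these bounds.
      Hence the start \<open>T = h0\<close>.\<close>
    have h_range: "0 \<le> h k t" "h k t \<in> {t - H..t}" if "k \<in> {1..m}" "h0 \<le> t" for k t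
      using delay[of k t] h_le[of k t] that \<open>0 \<le> h0\<close> H(1) by auto
    have ac: "abs_continuous_on_interval a b x" if "h0 \<le> a" for a b
    proof (rule abs_continuous_on_interval_subset)
      \<comment> \<open>The predicate \<open>is_solution\<close> covers ordered endpoints, while the
        locale quantifies over arbitrary \<open>b\<close>.\<close>
      show "abs_continuous_on_interval a (max a b) x"
        using sol that \<open>0 \<le> h0\<close> unfolding is_solution_def by simp
    qed auto
    have "delay_inequality a0 A b0 H h0 N x"
    proof
      fix t assume t: "h0 \<le> t" "t \<notin> N"
      then obtain D where D: "(x has_real_derivative D) (at t)"
        "D + f t (x t) + (\<Sum>k=1..m. g k t (x (h k t))) = 0" using N(2)[of t] \<open>0 \<le> h0\<close> by auto
      have "D \<le> b0 * \<nu> - a0 * max (x t) 0 - A * min (x t) 0"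
        if \<nu>: "0 \<le> \<nu>" "\<forall>s\<in>{t - H..t}. - \<nu> \<le> x s" for \<nu>
      proof -
        have "(\<Sum>k=1..m. - b k * \<nu>) \<le> (\<Sum>k=1..m. g k t (x (h k t)))"
          using \<nu> h_range t \<open>0 \<le> h0\<close> by (intro sum_mono g_lower) auto
        moreover have "(\<Sum>k=1..m. - b k * \<nu>) = - (b0 * \<nu>)"
          by (simp add: b0 sum_negf sum_distrib_right)
        ultimately show ?thesis using D(2) f_lower[of t] t \<open>0 \<le> h0\<close> by linarith
      qed
      then show "\<exists>D. (x has_real_derivative D) (at t) \<and> (\<forall>\<nu>\<ge>0. (\<forall>s\<in>{t - H..t}. - \<nu> \<le> x s) \<longrightarrow>
          D \<le> b0 * \<nu> - a0 * max (x t) 0 - A * min (x t) 0)"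
        using D(1) by blast
    qed (use ac N(1) pos H \<open>a0 \<le> A\<close> \<open>0 < b0\<close> in auto)
    \<comment> \<open>The equation need not be odd, but the bounds on the quotients are symmetric in
      sign: \<open>f_upper\<close> and \<open>g_upper\<close> give the same inequality for
      \<open>- x\<close>.\<close>
    moreover have "delay_inequality a0 A b0 H h0 N (\<lambda>t. - x t)"
    proof
      fix t assume t: "h0 \<le> t" "t \<notin> N"
      then obtain D where D: "(x has_real_derivative D) (at t)"
        "D + f t (x t) + (\<Sum>k=1..m. g k t (x (h k t))) = 0" using N(2)[of t] \<open>0 \<le> h0\<close> by auto
      have "- D \<le> b0 * \<nu> - a0 * max (- x t) 0 - A * min (- x t) 0"
        if \<nu>: "0 \<le> \<nu>" "\<forall>s\<in>{t - H..t}. - \<nu> \<le> - x s" for \<nu>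
      proof -
        have "(\<Sum>k=1..m. g k t (x (h k t))) \<le> (\<Sum>k=1..m. b k * \<nu>)"
          using \<nu> h_range t \<open>0 \<le> h0\<close> by (intro sum_mono g_upper) auto
        also have "\<dots> = b0 * \<nu>" by (simp add: b0 sum_distrib_right)
        finally have "- D \<le> b0 * \<nu> + (A * max (x t) 0 + a0 * min (x t) 0)"
          using D(2) f_upper[of t] t \<open>0 \<le> h0\<close> by linarith
        then show ?thesis by (auto simp: max_def min_def split: if_splits)
      qed
      then show "\<exists>D. ((\<lambda>t. - x t) has_real_derivative D) (at t) \<and> (\<forall>\<nu>\<ge>0. (\<forall>s\<in>{t - H..t}. - \<nu> \<le> - x s) \<longrightarrow>
          D \<le> b0 * \<nu> - a0 * max (- x t) 0 - A * min (- x t) 0)"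
        using D(1) by (intro exI[of _ "- D"]) (auto intro: DERIV_minus)
    qed (use abs_continuous_on_interval_minus[OF ac] N(1) pos H \<open>a0 \<le> A\<close> \<open>0 < b0\<close> in auto)
    moreover have "\<bar>x t\<bar> \<le> max (- x1) x2" if "h0 \<le> t" for t
      using x_bounds[of t] that \<open>0 \<le> h0\<close> by (auto simp: abs_if)
    ultimately show ?thesis
      by (rule two_sided_delay_inequality_tendsto_0) (use H(3,4) in \<open>simp_all add: q_def\<close>)
  qed
qed

end
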